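(* For every positive integer $m$, the function $H_m:\mathbb{N}\to\{0,1\}$ is completely multiplicative, i.e. $H_m(xy)=H_m(x)H_m(y)$ for all positive integers $x,y$.
   Context: For $m,n\in\mathbb{N}$, the Schemmel totient function $L_m(n)$ is the number of integers $k\in\{1,\dots,n\}$ such that $\gcd(k+s,n)=1$ for all $s\in\{0,1,\dots,m-1\}$; by convention $L_m(0)=0$. Equivalently, $L_m(1)=1$, and for $n>1$ with canonical prime factorization $n=\prod_{i=1}^r p_i^{\alpha_i}$, $L_m(n)=0$ if the smallest prime factor of $n$ is $\le m$, and $L_m(n)=\prod_{i=1}^r p_i^{\alpha_i-1}(p_i-m)$ otherwise. For a function $f$, $f^{(1)}=f$ and $f^{(k+1)}=f\circ f^{(k)}$. For $m,n\in\mathbb{N}$, $R_m(n)$ is the least positive integer $k$ such that $L_m^{(k)}(n)\in\{0,1\}$, and $H_m(n)=L_m^{(R_m(n))}(n)\in\{0,1\}$. *)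

theory Defs
  imports Main
begin

text \<open>Iteration is \<open>^^\<close>. The convention \<open>L_m(0) = 0\<close> holds automatically, as \<open>{1..0}\<close> is empty.\<close>

definition schemmel_L :: "nat \<Rightarrow> nat \<Rightarrow> nat" where
  "schemmel_L m n = card {k \<in> {1..n}. \<forall>s\<in>{0..<m}. gcd (k + s) n = 1}"

text \<open>The least \<open>k\<close> below exists whenever \<open>m > 0\<close>, since then \<open>L_m(n) < n\<close> for \<open>n > 1\<close>; for \<open>m = 0\<close>
  (where \<open>L_m\<close> is the identity) the value is unspecified when \<open>n > 1\<close>.\<close>

definition schemmel_R :: "nat \<Rightarrow> nat \<Rightarrow> nat" where
  "schemmel_R m n = (LEAST k. 0 < k \<and> (schemmel_L m ^^ k) n \<in> {0, 1})"

definition schemmel_H :: "nat \<Rightarrow> nat \<Rightarrow> nat" where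
  "schemmel_H m n = (schemmel_L m ^^ schemmel_R m n) n"

end

theory Submission
  imports Defs "HOL-Number_Theory.Cong"
begin

text \<open>
  Since \<open>L_m(n) < n\<close> for \<open>n > 1\<close>, the iteration reaches \<open>{0, 1}\<close>, and \<open>H_m(n) = H_m(L_m(n))\<close>.
  Multiplicativity follows by strong induction on the product \<open>x y\<close>, where peeling off primes reduces
  to the case that \<open>x = p\<close> is prime: \<open>L_m(p y)\<close> equals \<open>p L_m(y)\<close> or \<open>L_m(p) L_m(y)\<close> according to whether
  \<open>p\<close> divides \<open>y\<close>, and in both cases the induction hypothesis applies to this smaller number.
\<close>

lemma coprime_mod_add_iff:
  fixes k n s :: nat
  shows "coprime (k mod n + s) n \<longleftrightarrow> coprime (k + s) n"
proof (cases "n = 0")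
  case False
  then show ?thesis
    by (metis coprime_mod_left_iff mod_add_left_eq)
qed simp

text \<open>The condition depends only on the residue of \<open>k\<close> modulo \<open>n\<close>,
  so \<open>{1..n}\<close> can be traded for the residues below \<open>n\<close>, which suit
  \<open>mod\<close>, \<open>div\<close> and the Chinese remainder theorem.\<close>

lemma schemmel_L_altdef:
  "schemmel_L m n = card {k. k < n \<and> (\<forall>s<m. coprime (k + s) n)}"
proof -
  have "bij_betw (\<lambda>k. k mod n) {k \<in> {1..n}. \<forall>s<m. coprime (k + s) n}
      {k. k < n \<and> (\<forall>s<m. coprime (k + s) n)}"
  \<comment> \<open>Reduction moves only the endpoint \<open>n\<close>, to \<open>0\<close>; the
    witness undoes exactly that.\<close>
  proof (rule bij_betw_byWitness[where f' = "\<lambda>k. if k = 0 then n else k"])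
    show "(\<lambda>k. if k = 0 then n else k) ` {k. k < n \<and> (\<forall>s<m. coprime (k + s) n)}
        \<subseteq> {k \<in> {1..n}. \<forall>s<m. coprime (k + s) n}"
      using coprime_mod_add_iff[of n n] by auto
  qed (auto simp: coprime_mod_add_iff le_less)
  then show ?thesis
    unfolding schemmel_L_def coprime_iff_gcd_eq_1[symmetric] Ball_def atLeast0LessThan lessThan_iff
    by (rule bij_betw_same_card)
qed

lemma schemmel_L_0 [simp]: "schemmel_L m 0 = 0"
  by (simp add: schemmel_L_def)

lemma schemmel_L_1 [simp]: "schemmel_L m (Suc 0) = Suc 0"
  by (simp add: schemmel_L_def)

text \<open>As \<open>m > 0\<close>, the shift \<open>s = 0\<close> forces \<open>k\<close> itself
  to be coprime to \<open>n\<close>. This excludes \<open>k = 0\<close> when \<open>n > 1\<close>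
  and leaves at most \<open>n - 1\<close> residues.\<close>

lemma schemmel_L_less:
  assumes "m > 0" "n > 1"
  shows "schemmel_L m n < n"
proof -
  have "{k. k < n \<and> (\<forall>s<m. coprime (k + s) n)} \<subseteq> {1..<n}"
  proof
    fix k assume "k \<in> {k. k < n \<and> (\<forall>s<m. coprime (k + s) n)}"
    then have "k < n" "coprime k n"
      using assms by auto
    then show "k \<in> {1..<n}"
      using assms by (cases k) auto
  qed
  then have "schemmel_L m n \<le> card {1..<n}"
    unfolding schemmel_L_altdef by (intro card_mono) auto
  then show ?thesis
    using assms by simp
qed

text \<open>Chinese remainder theorem: a residue modulo \<open>a * b\<close> is admissible exactly
  when its reductions modulo \<open>a\<close> and modulo \<open>b\<close> both are.\<close>

lemma schemmel_L_mult_coprime: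
  assumes "coprime a b"
  shows "schemmel_L m (a * b) = schemmel_L m a * schemmel_L m b"
proof (cases "a = 0 \<or> b = 0")
  case True
  then show ?thesis by auto
next
  case False
  define A where "A n = {k. k < n \<and> (\<forall>s<m. coprime (k + s) n)}" for n
  have "bij_betw (\<lambda>k. (k mod a, k mod b)) (A (a * b)) (A a \<times> A b)"
    unfolding bij_betw_def
  proof
    show "inj_on (\<lambda>k. (k mod a, k mod b)) (A (a * b))"
    proof (rule inj_onI)
      fix x y assume "x \<in> A (a * b)" "y \<in> A (a * b)" "(x mod a, x mod b) = (y mod a, y mod b)"
      then show "x = y"
        using coprime_cong_mult_nat[OF _ _ assms, of x y] by (simp add: A_def cong_def)
    qed
    show "(\<lambda>k. (k mod a, k mod b)) ` A (a * b) = A a \<times> A b"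
    proof (intro equalityI subsetI)
      fix z assume "z \<in> (\<lambda>k. (k mod a, k mod b)) ` A (a * b)"
      then show "z \<in> A a \<times> A b"
        using False by (auto simp: A_def coprime_mod_add_iff)
    next
      fix z assume "z \<in> A a \<times> A b"
      then obtain u v where uv: "z = (u, v)" "u \<in> A a" "v \<in> A b"
        by auto
      obtain k where k: "k < a * b" "[k = u] (mod a)" "[k = v] (mod b)"
        using binary_chinese_remainder_unique_nat[OF assms, of u v] False by auto
      then have *: "k mod a = u" "k mod b = v"
        using uv by (simp_all add: A_def cong_def)
      have "k \<in> A (a * b)"
        using k(1) uv(2,3) unfolding *[symmetric] by (simp add: A_def coprime_mod_add_iff)
      then show "z \<in> (\<lambda>k. (k mod a, k mod b)) ` A (a * b)"
        using uv(1) * by force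
    qed
  qed
  then show ?thesis
    unfolding schemmel_L_altdef A_def[symmetric]
    by (simp add: bij_betw_same_card card_cartesian_product)
qed

text \<open>Every prime factor of \<open>d * n\<close> already divides \<open>n\<close>, so
  admissibility modulo \<open>d * n\<close> depends only on the residue modulo \<open>n\<close>, and
  each residue modulo \<open>n\<close> has \<open>d\<close> lifts \<open>q * n + r\<close> with
  \<open>q < d\<close>.\<close>

lemma schemmel_L_mult_dvd:
  assumes "d dvd n"
  shows "schemmel_L m (d * n) = d * schemmel_L m n"
proof (cases "n = 0")
  case True
  then show ?thesis by simp
next
  case False
  define A where "A n = {k. k < n \<and> (\<forall>s<m. coprime (k + s) n)}" for n
  have cop: "coprime k (d * n) \<longleftrightarrow> coprime k n" for k
    using assms by (auto intro: coprime_divisors[of k k d n])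
  have "bij_betw (\<lambda>k. (k div n, k mod n)) (A (d * n)) ({..<d} \<times> A n)"
  proof (rule bij_betw_byWitness[where f' = "\<lambda>(q, r). q * n + r"])
    show "(\<lambda>k. (k div n, k mod n)) ` A (d * n) \<subseteq> {..<d} \<times> A n"
      using False by (auto simp: A_def coprime_mod_add_iff less_mult_imp_div_less cop)
    show "(\<lambda>(q, r). q * n + r) ` ({..<d} \<times> A n) \<subseteq> A (d * n)"
    proof safe
      fix q r assume q: "q < d" and r: "r \<in> A n"
      have "q * n + r < Suc q * n"
        using r by (simp add: A_def)
      also have "\<dots> \<le> d * n"
        using q by (intro mult_right_mono) auto
      finally have "q * n + r < d * n" .
      moreover have "coprime (q * n + r + s) n \<longleftrightarrow> coprime (r + s) n" for s
        using coprime_mod_add_iff[of "q * n + r" n s] coprime_mod_add_iff[of r n s] by simp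
      ultimately show "q * n + r \<in> A (d * n)"
        using r by (simp only: A_def mem_Collect_eq cop) simp
    qed
  qed (auto simp: A_def)
  then show ?thesis
    unfolding schemmel_L_altdef A_def[symmetric]
    by (simp add: bij_betw_same_card card_cartesian_product)
qed

lemma ex_schemmel_L_funpow:
  assumes "m > 0"
  shows "\<exists>k>0. (schemmel_L m ^^ k) n \<in> {0, 1}"
proof (induction n rule: less_induct)
  case (less n)
  show ?case
  proof (cases "n > 1")
    case True
    then obtain k where "k > 0" "(schemmel_L m ^^ k) (schemmel_L m n) \<in> {0, 1}"
      using less[OF schemmel_L_less[OF assms]] by blast
    then show ?thesis
      by (intro exI[of _ "Suc k"]) (simp add: funpow_swap1)
  next
    case False
    then have "n = 0 \<or> n = Suc 0"
      by auto
    \<comment> \<open>The exponent must be positive, so \<open>0\<close> and \<open>1\<close> are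
      iterated once; both are fixed points.\<close>
    then show ?thesis
      by (intro exI[of _ 1]) auto
  qed
qed

lemma schemmel_H_binary:
  assumes "m > 0"
  shows "schemmel_H m n \<in> {0, 1}"
  using LeastI_ex[OF ex_schemmel_L_funpow[OF assms, of n]]
  unfolding schemmel_H_def schemmel_R_def by blast

text \<open>Both \<open>0\<close> and \<open>1\<close> are fixed points of
  \<open>schemmel_L m\<close>, so an orbit that has entered \<open>{0, 1}\<close> stays constant.
  Any positive exponent that lands there can thus replace the least one.\<close>

lemma schemmel_H_eqI:
  assumes "k > 0" "(schemmel_L m ^^ k) n = v" "v \<in> {0, 1}"
  shows "schemmel_H m n = v"
proof -
  define R where "R = schemmel_R m n"
  have R: "(schemmel_L m ^^ R) n \<in> {0, 1}" "R \<le> k"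
    using assms LeastI[of "\<lambda>k. 0 < k \<and> (schemmel_L m ^^ k) n \<in> {0, 1}" k]
      Least_le[of "\<lambda>k. 0 < k \<and> (schemmel_L m ^^ k) n \<in> {0, 1}" k]
    unfolding R_def schemmel_R_def by auto
  have stable: "(schemmel_L m ^^ j) w = w" if "w \<in> {0, 1}" for j w
    using that by (induction j) auto
  have "v = (schemmel_L m ^^ (k - R)) ((schemmel_L m ^^ R) n)"
    using assms(2) R(2) by (simp flip: funpow_add comp_apply[of "_ ^^ _" "_ ^^ _"])
  then show ?thesis
    using stable[OF R(1)] by (simp add: schemmel_H_def R_def)
qed

lemma schemmel_H_0 [simp]: "schemmel_H m 0 = 0"
  by (rule schemmel_H_eqI[of 1]) auto

lemma schemmel_H_1 [simp]: "schemmel_H m (Suc 0) = Suc 0"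
  by (rule schemmel_H_eqI[of 1]) auto

lemma schemmel_H_schemmel_L:
  assumes "m > 0"
  shows "schemmel_H m (schemmel_L m n) = schemmel_H m n"
proof -
  obtain k where "k > 0" "(schemmel_L m ^^ k) (schemmel_L m n) \<in> {0, 1}"
    using ex_schemmel_L_funpow[OF assms] by blast
  then show ?thesis
    using schemmel_H_eqI[of k m "schemmel_L m n"] schemmel_H_eqI[of "Suc k" m n]
    by (simp add: funpow_swap1)
qed

lemma schemmel_H_mult:
  assumes "m > 0"
  shows "schemmel_H m (x * y) = schemmel_H m x * schemmel_H m y"
proof (induction "x * y" arbitrary: x y rule: less_induct)
  case less
  \<comment> \<open>Here \<open>p * z\<close> equals \<open>x * y\<close> itself, so the induction
    hypothesis becomes available only after one application of \<open>schemmel_L m\<close>;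
    \<open>lt\<close> records that decrease.\<close>
  have prime_case: "schemmel_H m (p * z) = schemmel_H m p * schemmel_H m z"
    if p: "prime p" and pz: "p * z = x * y" and "z > 0" for p z
  proof -
    have lt: "schemmel_L m (p * z) < x * y"
      using schemmel_L_less[OF assms, of "p * z"] prime_gt_1_nat[OF p] \<open>z > 0\<close> pz
      by (metis One_nat_def Suc_leI less_1_mult mult.right_neutral nat_less_le)
    show ?thesis
    proof (cases "p dvd z")
      case True
      then have "schemmel_H m (p * z) = schemmel_H m (p * schemmel_L m z)"
        by (metis schemmel_L_mult_dvd schemmel_H_schemmel_L[OF assms])
      also have "\<dots> = schemmel_H m p * schemmel_H m (schemmel_L m z)"
        using lt by (intro less) (simp add: schemmel_L_mult_dvd[OF True])
      finally show ?thesis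
        by (simp add: schemmel_H_schemmel_L[OF assms])
    next
      case False
      then have *: "schemmel_L m (p * z) = schemmel_L m p * schemmel_L m z"
        by (intro schemmel_L_mult_coprime prime_imp_coprime p)
      then have "schemmel_H m (p * z) = schemmel_H m (schemmel_L m p * schemmel_L m z)"
        by (metis schemmel_H_schemmel_L[OF assms])
      also have "\<dots> = schemmel_H m (schemmel_L m p) * schemmel_H m (schemmel_L m z)"
        using lt by (intro less) (simp add: *)
      finally show ?thesis
        by (simp add: schemmel_H_schemmel_L[OF assms])
    qed
  qed
  consider "x = 0 \<or> y = 0" | "x = 1" | "y = 1" | "x > 1" "y > 1"
    by linarith
  then show ?case
  proof cases
    case 4
    then obtain p z where p: "prime p" and x: "x = p * z"
      by (metis dvd_def less_irrefl prime_factor_nat)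
    have pos: "p > 1" "z > 0"
      using p 4 x prime_gt_1_nat by (auto intro: gr0I)
    \<comment> \<open>Split \<open>p\<close> off the whole product, then use the induction
      hypothesis twice: on \<open>z * y\<close>, smaller because \<open>p > 1\<close>, and on
      \<open>p * z = x\<close>, smaller because \<open>y > 1\<close>.\<close>
    have "schemmel_H m (x * y) = schemmel_H m p * schemmel_H m (z * y)"
      using prime_case[OF p, of "z * y"] pos 4 x by (simp add: mult.assoc)
    also have "schemmel_H m (z * y) = schemmel_H m z * schemmel_H m y"
      using pos 4 x by (intro less) simp
    also have "schemmel_H m p * (schemmel_H m z * schemmel_H m y) = schemmel_H m (p * z) * schemmel_H m y"
      using less[of p z] pos 4 x by simp
    finally show ?thesis
      by (simp add: x)
  qed auto
qed

theorem theorem1p3: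
  fixes m :: nat
  assumes "m > 0"
  shows "(\<forall>n. schemmel_H m n \<in> {0, 1}) \<and>
    (\<forall>x y. x > 0 \<longrightarrow> y > 0 \<longrightarrow> schemmel_H m (x * y) = schemmel_H m x * schemmel_H m y)"
  using schemmel_H_binary[OF assms] schemmel_H_mult[OF assms] by blast

end
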